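(* For integers $n\ge k\ge0$, $$\mathcal{B}_{n,2k}^{(k)}(1)=(-1)^n\,k!\sum_{\nu=0}^{k}\binom{2k-\nu}{k}\binom{n}{\nu}\mathbf{B}_{n-\nu}.$$ The numbers $\mathfrak{b}_{n,k}=\mathcal{B}_{n,2k}^{(k)}(1)$ satisfy, for $n\ge2$ and $0\le k\le n-2$, the recurrence $$\mathfrak{b}_{n,k+2}=2(2k+3)\,\mathfrak{b}_{n,k+1}+n(n-1)\,\mathfrak{b}_{n-2,k}.$$ For odd $n\ge3$, $$\widehat{\mathfrak{f}}_{n,k}=\mathfrak{b}_{n,k+1}\quad(0\le k<n)\qquad\text{and}\qquad(-1)^{\mathbf{d}_n+1}\,\widehat{\mathfrak{f}}_{n,k}>0\quad(0\le k\le\mathbf{d}_n).$$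
   Context: Bernoulli polynomials: $\frac{te^{xt}}{e^t-1}=\sum_{n\ge0}\mathbf{B}_n(x)\frac{t^n}{n!}$, and $\mathbf{B}_n=\mathbf{B}_n(0)$ (so $\mathbf{B}_1=-\frac12$). Generalized reciprocal Bernoulli polynomials: $\mathcal{B}_{n,k}(x)=x^k\,\mathbf{B}_n(x^{-1})$ for $n\ge0$, $k\in\mathbb{Z}$; $\mathcal{B}_{n,k}^{(\ell)}$ denotes the $\ell$-th derivative in $x$. Power sums: $S_n(x)=\frac{1}{n+1}(\mathbf{B}_{n+1}(x)-\mathbf{B}_{n+1})$, so that $S_n(m)=\sum_{\nu=0}^{m-1}\nu^n$; in particular $S_1(x)=\binom{x}{2}$. Faulhaber polynomials for odd index (classical Faulhaber–Jacobi theorem): for each odd $n\ge3$ there is a unique polynomial $F_n\in\mathbb{Q}[y]$, of degree $\mathbf{d}_n=\lfloor n/2\rfloor-1=(n-3)/2$, such that $S_n(x)=S_1(x)^2\,F_n(S_1(x))$. Its coefficients are denoted $F_n(y)=\sum_{k\ge0}\mathfrak{f}_{n,k}\,y^k$, with $\mathfrak{f}_{n,k}=0$ for $k>\mathbf{d}_n$. The modified coefficients $\widehat{\mathfrak{f}}_{n,k}$ are defined by $$\mathfrak{f}_{n,k}=(-1)^{k+1}\frac{2^{k+2}}{(k+2)!}\,\widehat{\mathfrak{f}}_{n,k}.$$ *)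

theory Defs
  imports
    "HOL-Computational_Algebra.Formal_Power_Series"
    "HOL-Analysis.Analysis"
begin

text \<open>
  Bernoulli polynomials are represented by their values at \<open>x\<close>, over an arbitrary field of
  characteristic zero: real arguments are needed for the derivatives below, rational ones for
  the Faulhaber polynomials. The quotient is one of formal power series in \<open>t\<close>, in which the
  common factor \<open>t\<close> of \<open>t e\<^sup>x\<^sup>t\<close> and \<open>e\<^sup>t - 1\<close> cancels.
\<close>

definition bernpoly :: "nat \<Rightarrow> 'a::field_char_0 \<Rightarrow> 'a" where
  "bernpoly n x = fact n * fps_nth (fps_X * fps_exp x / (fps_exp 1 - 1)) n"

definition bernoulli :: "nat \<Rightarrow> 'a::field_char_0" where
  "bernoulli n = bernpoly n 0"

definition recip_bernpoly :: "nat \<Rightarrow> int \<Rightarrow> real \<Rightarrow> real" where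
  "recip_bernpoly n k x = x powi k * bernpoly n (inverse x)"

definition frak_b :: "nat \<Rightarrow> nat \<Rightarrow> real" where
  "frak_b n k = (deriv ^^ k) (recip_bernpoly n (2 * int k)) 1"

definition power_sum :: "nat \<Rightarrow> 'a::field_char_0 \<Rightarrow> 'a" where
  "power_sum n x = (bernpoly (n + 1) x - bernoulli (n + 1)) / of_nat (n + 1)"

definition faulhaber_deg :: "nat \<Rightarrow> nat" where
  "faulhaber_deg n = n div 2 - 1"

text \<open>
  Meaningful for odd \<open>n \<ge> 3\<close> only. Since \<open>\<rat>\<close> is infinite, the identity for all rational \<open>x\<close>
  is the identity of polynomials.
\<close>

definition faulhaber_poly :: "nat \<Rightarrow> rat poly" where
  "faulhaber_poly n = (THE F. degree F = faulhaber_deg n \<and>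
     (\<forall>x::rat. power_sum n x = (power_sum 1 x)\<^sup>2 * poly F (power_sum 1 x)))"

definition faulhaber_coeff :: "nat \<Rightarrow> nat \<Rightarrow> rat" where
  "faulhaber_coeff n k = coeff (faulhaber_poly n) k"

text \<open>
  The solution \<open>f'\<close> of \<open>faulhaber_coeff n k = (-1)\<^sup>k\<^sup>+\<^sup>1 * 2\<^sup>k\<^sup>+\<^sup>2 / (k + 2)! * f'\<close>.
\<close>

definition faulhaber_coeff_mod :: "nat \<Rightarrow> nat \<Rightarrow> rat" where
  "faulhaber_coeff_mod n k =
     faulhaber_coeff n k / ((-1) ^ (k + 1) * (2 ^ (k + 2) / fact (k + 2)))"

end

theory Submission
  imports Defs
begin

text \<open>
  Near \<open>x = 1\<close> the reflection formula gives
  \<open>x\<^sup>2\<^sup>k B\<^sub>n(1/x) = (-1)\<^sup>n (\<Sum>j. (n choose j) B\<^sub>n\<^sub>-\<^sub>j x\<^sup>2\<^sup>k\<^sup>-\<^sup>j (x - 1)\<^sup>j)\<close>, so that the \<open>k\<close>-th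
  derivative at \<open>1\<close> only sees \<open>j \<le> k\<close>. The resulting sum is, up to \<open>(-1)\<^sup>n n!\<close>, the
  coefficient of \<open>t\<^sup>n\<close> in \<open>P\<^sub>k(t) t / (e\<^sup>t - 1)\<close>, where the Bessel-type polynomials \<open>P\<^sub>k\<close> satisfy
  \<open>P\<^sub>k\<^sub>+\<^sub>2 = 2 (2 k + 3) P\<^sub>k\<^sub>+\<^sub>1 + t\<^sup>2 P\<^sub>k\<close>; this is the recurrence. The same recurrence expresses
  \<open>S\<^sub>n'' = n (n - 1) S\<^sub>n\<^sub>-\<^sub>2 + n B\<^sub>n\<^sub>-\<^sub>1\<close> in the variable \<open>y = S\<^sub>1(x)\<close>, and \<open>S\<^sub>n\<close> is determined by its second
  derivative and its zeros \<open>0\<close> and \<open>1\<close>, which identifies the Faulhaber coefficients by induction.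
  Their signs follow by reading the recurrence from the top index down, starting from a vanishing
  term.
\<close>

subsection \<open>Bernoulli polynomials\<close>

lemma subdegree_fps_exp_minus_1: "subdegree (fps_exp (1::'a::field_char_0) - 1) = 1"
  by (rule subdegreeI) auto

lemma fps_exp_minus_1_nonzero: "fps_exp (1::'a::field_char_0) - 1 \<noteq> 0"
  using subdegree_fps_exp_minus_1[where 'a = 'a] by force

text \<open>The exponential generating function of the Bernoulli numbers. Once
  \<open>fps_exp x\<close> is split off, identities between Bernoulli numbers follow by cancelling
  \<open>fps_exp 1 - 1\<close>.\<close>

definition bern_fps :: "'a::field_char_0 fps" where
  "bern_fps = fps_X / (fps_exp 1 - 1)"

text \<open>The quotient is exact because \<open>fps_exp 1 - 1\<close> and \<open>fps_X\<close> both
  have subdegree 1. As \<open>fps_exp 1 - 1\<close> is no zero divisor, this equation characterises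
  \<open>bern_fps\<close>.\<close>

lemma bern_fps_mult: "bern_fps * (fps_exp (1::'a::field_char_0) - 1) = fps_X"
  unfolding bern_fps_def
proof (rule dvd_div_mult_self)
  show "fps_exp 1 - 1 dvd (fps_X :: 'a fps)"
    unfolding fps_dvd_iff[OF fps_exp_minus_1_nonzero fps_X_neq_zero] subdegree_fps_exp_minus_1
    by simp
qed

lemma bernpoly_fps: "bernpoly n x = fact n * fps_nth (bern_fps * fps_exp x) n"
proof -
  have "fps_X * fps_exp x = (bern_fps * fps_exp x) * (fps_exp 1 - 1)"
    using bern_fps_mult[where 'a = 'a] by (simp add: mult_ac)
  then have "fps_X * fps_exp x / (fps_exp 1 - 1) = bern_fps * fps_exp x"
    using fps_exp_minus_1_nonzero[where 'a = 'a] by (metis nonzero_mult_div_cancel_right)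
  then show ?thesis
    by (simp add: bernpoly_def)
qed

lemma bernoulli_fps: "bernoulli n = fact n * fps_nth bern_fps n"
  by (simp add: bernoulli_def bernpoly_fps)

lemma bern_fps_nth: "fps_nth bern_fps n = bernoulli n / fact n"
  by (simp add: bernoulli_fps)

lemma bernpoly_expand:
  "bernpoly n x = (\<Sum>j\<le>n. of_nat (n choose j) * bernoulli (n - j) * x ^ j)"
proof -
  have "bernpoly n x = (\<Sum>j\<le>n. fact n * (bernoulli (n - j) / fact (n - j) * (x ^ j / fact j)))"
    unfolding bernpoly_fps mult.commute[of bern_fps] fps_mult_nth
    by (simp add: bern_fps_nth sum_distrib_left atLeast0AtMost mult_ac)
  also have "\<dots> = (\<Sum>j\<le>n. of_nat (n choose j) * bernoulli (n - j) * x ^ j)"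
    by (rule sum.cong) (auto simp: binomial_fact field_simps)
  finally show ?thesis .
qed

text \<open>The substitution of -t for t turns t/(e^t - 1) into t e^t/(e^t - 1) and multiplies the
  n-th coefficient by (-1)^n.\<close>

lemma bernpoly_reflect: "bernpoly n (1 - x) = (-1) ^ n * bernpoly n x"
proof -
  let ?N = "\<lambda>f :: 'a fps. fps_compose f (- fps_X)"
  have e: "?N (fps_exp c) = fps_exp (- c)" for c :: 'a
    using fps_exp_compose_linear[of c "-1"] by (simp flip: fps_const_neg)
  have "?N bern_fps * (fps_exp (- 1) - 1) = ?N (bern_fps * (fps_exp 1 - 1))"
    by (simp add: fps_compose_mult_distrib fps_compose_sub_distrib e)
  also have "\<dots> = - fps_X"
    by (simp add: bern_fps_mult)
  finally have "?N bern_fps * ((fps_exp (- 1) - 1) * fps_exp 1) = - (fps_X * fps_exp 1)"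
    by (metis mult.assoc mult_minus_left)
  also have "(fps_exp (- 1) - 1) * fps_exp 1 = - (fps_exp 1 - 1 :: 'a fps)"
    by (simp add: algebra_simps flip: fps_exp_add_mult)
  finally have "?N bern_fps * (fps_exp 1 - 1) = bern_fps * (fps_exp 1 - 1) * fps_exp 1"
    by (simp only: bern_fps_mult mult_minus_right neg_equal_iff_equal)
  then have "?N bern_fps * (fps_exp 1 - 1) = bern_fps * fps_exp 1 * (fps_exp 1 - 1)"
    by (simp only: mult_ac)
  then have N: "?N bern_fps = bern_fps * fps_exp 1"
    using fps_exp_minus_1_nonzero[where 'a = 'a] by (metis mult_right_cancel)
  have "?N (bern_fps * fps_exp x) = bern_fps * fps_exp (1 - x)"
    by (simp add: fps_compose_mult_distrib e N mult.assoc flip: fps_exp_add_mult)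
  moreover have "fps_nth (?N f) n = (-1) ^ n * fps_nth f n" for f
    using fps_compose_linear[of f "-1"] by (simp flip: fps_const_neg)
  ultimately have "fps_nth (bern_fps * fps_exp (1 - x)) n = (-1) ^ n * fps_nth (bern_fps * fps_exp x) n"
    by metis
  then show ?thesis
    by (simp add: bernpoly_fps)
qed

lemma bernpoly_at_1: "bernpoly n 1 = bernoulli n + (if n = 1 then 1 else 0)"
proof -
  have "bern_fps * fps_exp 1 = bern_fps + (fps_X :: 'a fps)"
    using bern_fps_mult[where 'a = 'a] by (simp add: algebra_simps)
  then show ?thesis
    by (simp add: bernpoly_fps bernoulli_fps)
qed

text \<open>Two evaluations of B_1(1) are compared: B_1 + B_0 by expansion and B_1 + 1 by
  \<open>bernpoly_at_1\<close>.\<close>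

lemma bernoulli_0: "bernoulli 0 = 1"
  using bernpoly_at_1[where n = 1 and 'a = 'a] by (simp add: bernpoly_expand)

lemma bernoulli_1: "bernoulli 1 = (- 1 / 2 :: 'a::field_char_0)"
proof -
  have "- bernoulli 1 = bernoulli 1 + (1 :: 'a)"
    using bernpoly_reflect[of 1 "0 :: 'a"] bernpoly_at_1[where n = 1 and 'a = 'a]
    by (simp add: bernoulli_def)
  then have "bernoulli 1 + (bernoulli 1 + 1) = (0 :: 'a)"
    by (metis add.right_inverse)
  then have "bernoulli 1 * 2 = (- 1 :: 'a)"
    by (simp add: mult_2_right eq_neg_iff_add_eq_0 add.assoc)
  then show ?thesis
    by (subst nonzero_eq_divide_eq) auto
qed

lemma bernoulli_odd: "bernoulli n = (0 :: 'a::field_char_0)" if "odd n" "n \<noteq> 1"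
proof -
  have "bernoulli n = - (bernoulli n :: 'a)"
    using bernpoly_reflect[of n "0 :: 'a"] bernpoly_at_1[where n = n and 'a = 'a] that
    by (simp add: bernoulli_def)
  then show ?thesis
    by simp
qed

text \<open>Coefficientwise \<open>of_rat\<close> preserves the equation
  \<open>bern_fps_mult\<close>, which determines the series. This links the real derivatives to the
  rational Faulhaber coefficients.\<close>

lemma of_rat_bernoulli: "of_rat (bernoulli n) = (bernoulli n :: 'a::field_char_0)"
proof -
  let ?h = "\<lambda>f. Abs_fps (\<lambda>n. of_rat (fps_nth f n) :: 'a)"
  have h: "of_rat (fact k) = (fact k :: 'a)" for k
    by (metis of_nat_fact of_rat_of_nat_eq)
  have "?h bern_fps * (fps_exp 1 - 1) = ?h (bern_fps * (fps_exp 1 - 1))"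
    by (rule fps_ext)
       (simp add: fps_mult_nth of_rat_sum of_rat_mult of_rat_diff of_rat_divide h if_distrib[of of_rat] cong: if_cong)
  also have "\<dots> = bern_fps * (fps_exp 1 - 1)"
    by (auto simp: bern_fps_mult fps_eq_iff)
  finally have "?h bern_fps = bern_fps"
    using fps_exp_minus_1_nonzero[where 'a = 'a] by (metis mult_right_cancel)
  then have "of_rat (fps_nth bern_fps n) = fps_nth (bern_fps :: 'a fps) n"
    by (metis fps_nth_Abs_fps)
  then show ?thesis
    by (simp add: bernoulli_fps of_rat_mult h)
qed

subsection \<open>The closed formula and its recurrence\<close>

text \<open>The right-hand side of the closed formula, over any field so as to serve both reals and
  rationals. For \<open>\<nu> > n\<close> the truncated \<open>n - \<nu>\<close> is harmless, since
  \<open>n choose \<nu>\<close> vanishes.\<close>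

definition bsum :: "nat \<Rightarrow> nat \<Rightarrow> 'a::field_char_0" where
  "bsum n k = (-1) ^ n * fact k *
     (\<Sum>\<nu>=0..k. of_nat ((2 * k - \<nu>) choose k) * of_nat (n choose \<nu>) * bernoulli (n - \<nu>))"

lemma of_rat_bsum: "of_rat (bsum n k) = (bsum n k :: 'a::field_char_0)"
proof -
  have "of_rat (fact k) = (fact k :: 'a)"
    by (metis of_nat_fact of_rat_of_nat_eq)
  then show ?thesis
    by (simp add: bsum_def of_rat_mult of_rat_sum of_rat_bernoulli of_rat_power of_rat_minus)
qed

text \<open>Reversed Bessel polynomials, up to a rescaling of the variable.\<close>

definition bessel_fps :: "nat \<Rightarrow> 'a::field_char_0 fps" where
  "bessel_fps k = Abs_fps (\<lambda>\<nu>. if \<nu> \<le> k then fact (2 * k - \<nu>) / (fact (k - \<nu>) * fact \<nu>) else 0)"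

text \<open>With k + 2 = \<open>\<nu>\<close> + a and M = 2k + 2 - \<open>\<nu>\<close>, all three
  coefficients become multiples of M!/(a! \<open>\<nu>\<close>!), and what remains is (M + 2)(M + 1)
  = 2(2k + 3)a + \<open>\<nu>\<close>(\<open>\<nu>\<close> - 1).\<close>

lemma bessel_fps_rec:
  "bessel_fps (k + 2) =
     fps_const (2 * (2 * of_nat k + 3)) * bessel_fps (k + 1) + fps_X ^ 2 * (bessel_fps k :: 'a::field_char_0 fps)"
proof (rule fps_ext)
  fix \<nu>
  show "fps_nth (bessel_fps (k + 2)) \<nu> =
     fps_nth (fps_const (2 * (2 * of_nat k + 3)) * bessel_fps (k + 1) + fps_X ^ 2 * (bessel_fps k :: 'a fps)) \<nu>"
  proof (cases "\<nu> \<le> k + 2")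
    case False
    then show ?thesis
      by (simp add: bessel_fps_def fps_X_power_mult_nth)
  next
    case True
    then obtain a where a: "k + 2 = \<nu> + a"
      using le_iff_add by metis
    have k: "of_nat k = of_nat \<nu> + of_nat a - (2 :: 'a)"
      using arg_cong[OF a, of "of_nat :: nat \<Rightarrow> 'a"] by (simp add: algebra_simps)
    define M where "M = 2 * k + 2 - \<nu>"
    have M: "of_nat M = of_nat \<nu> + 2 * of_nat a - (2 :: 'a)"
    proof -
      have "M + 2 = \<nu> + 2 * a"
        using a unfolding M_def by linarith
      from arg_cong[OF this, of "of_nat :: nat \<Rightarrow> 'a"] show ?thesis
        by (simp add: algebra_simps)
    qed
    have 1: "fps_nth (bessel_fps (k + 2)) \<nu> = (fact (M + 2) / (fact a * fact \<nu>) :: 'a)"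
    proof -
      have "2 * (k + 2) - \<nu> = M + 2 \<and> k + 2 - \<nu> = a"
        using a unfolding M_def by - (intro conjI; (linarith | simp))
      then show ?thesis
        using True by (simp only: bessel_fps_def fps_nth_Abs_fps if_True)
    qed
    \<comment> \<open>The factor \<open>of_nat a\<close> also covers a = 0, where the index exceeds
      the degree k + 1.\<close>
    have 2: "fps_nth (bessel_fps (k + 1)) \<nu> = (of_nat a * fact M / (fact a * fact \<nu>) :: 'a)"
    proof (cases a)
      case 0
      then show ?thesis
        using a by (simp add: bessel_fps_def)
    next
      case (Suc c)
      have "2 * (k + 1) - \<nu> = M \<and> k + 1 - \<nu> = c \<and> \<nu> \<le> k + 1"
        using a Suc unfolding M_def by - (intro conjI; (linarith | simp))
      then have "fps_nth (bessel_fps (k + 1)) \<nu> = (fact M / (fact c * fact \<nu>) :: 'a)"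
        by (simp only: bessel_fps_def fps_nth_Abs_fps if_True)
      then show ?thesis
        using Suc by (simp add: field_simps del: of_nat_Suc)
    qed
    have 3: "fps_nth (fps_X ^ 2 * bessel_fps k) \<nu> =
        (of_nat \<nu> * (of_nat \<nu> - 1) * fact M / (fact a * fact \<nu>) :: 'a)"
    proof (cases "\<nu> < 2")
      case True
      then have "\<nu> = 0 \<or> \<nu> = 1" by linarith
      then show ?thesis
        by (auto simp: fps_X_power_mult_nth)
    next
      case False
      then obtain m where m: "\<nu> = Suc (Suc m)"
        by (metis Suc_1 add_2_eq_Suc le_Suc_ex not_less)
      have "2 * k - m = M \<and> k - m = a \<and> m \<le> k \<and> \<nu> - 2 = m"
        using a m unfolding M_def by - (intro conjI; (linarith | simp))
      then have "fps_nth (fps_X ^ 2 * bessel_fps k) \<nu> = (fact M / (fact a * fact m) :: 'a)"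
        using False by (simp add: bessel_fps_def fps_X_power_mult_nth)
      moreover have "fact \<nu> = of_nat \<nu> * (of_nat \<nu> - 1) * (fact m :: 'a)"
        by (simp add: m algebra_simps)
      moreover have "of_nat \<nu> * (of_nat \<nu> - 1) \<noteq> (0 :: 'a)"
      proof -
        have "of_nat \<nu> * (of_nat \<nu> - 1) = (of_nat (\<nu> * Suc m) :: 'a)"
          by (simp add: m algebra_simps)
        then show ?thesis
          by (simp only: of_nat_eq_0_iff) (simp add: m)
      qed
      ultimately show ?thesis
        by simp
    qed
    have "fact (M + 2) = (of_nat M + 2) * (of_nat M + 1) * (fact M :: 'a)"
      by (simp add: algebra_simps)
    also have "(of_nat M + 2) * (of_nat M + 1) =
        2 * (2 * of_nat k + 3) * of_nat a + of_nat \<nu> * (of_nat \<nu> - 1 :: 'a)"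
      by (simp add: M k algebra_simps)
    finally have F: "fact (M + 2) = (2 * (2 * of_nat k + 3) * of_nat a + of_nat \<nu> * (of_nat \<nu> - 1)) * (fact M :: 'a)" .
    have "(c * r + w) * f / d = c * (r * f / d) + w * f / d" for c r w f d :: 'a
      by (simp add: add_divide_distrib algebra_simps)
    then show ?thesis
      unfolding fps_add_nth fps_mult_left_const_nth 1 2 3 F .
  qed
qed

lemma bsum_fps: "bsum n k = (-1) ^ n * fact n * fps_nth (bessel_fps k * bern_fps) n"
proof -
  have *: "fact k * (of_nat ((2 * k - \<nu>) choose k) * of_nat (n choose \<nu>) * bernoulli (n - \<nu>)) =
      (fact n * (fps_nth (bessel_fps k) \<nu> * fps_nth bern_fps (n - \<nu>)) :: 'a)" if "\<nu> \<le> k" "\<nu> \<le> n" for \<nu>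
  proof -
    have "k \<le> 2 * k - \<nu> \<and> 2 * k - \<nu> - k = k - \<nu>"
      using that by presburger
    then have "of_nat ((2 * k - \<nu>) choose k) = (fact (2 * k - \<nu>) / (fact k * fact (k - \<nu>)) :: 'a)"
      by (simp add: binomial_fact)
    then show ?thesis
      using that by (simp add: bessel_fps_def bern_fps_nth binomial_fact field_simps)
  qed
  \<comment> \<open>The sum runs to k, the Cauchy product to n; both are cut to
    \<open>min k n\<close>, beyond which the respective terms vanish.\<close>
  have "fact k * (\<Sum>\<nu>=0..k. of_nat ((2 * k - \<nu>) choose k) * of_nat (n choose \<nu>) * bernoulli (n - \<nu>)) =
      (\<Sum>\<nu>=0..min k n. fact k * (of_nat ((2 * k - \<nu>) choose k) * of_nat (n choose \<nu>) * bernoulli (n - \<nu>) :: 'a))"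
    unfolding sum_distrib_left by (rule sum.mono_neutral_right) auto
  also have "\<dots> = (\<Sum>\<nu>=0..min k n. fact n * (fps_nth (bessel_fps k) \<nu> * fps_nth bern_fps (n - \<nu>)))"
    by (rule sum.cong[OF refl], rule *) auto
  also have "\<dots> = (\<Sum>\<nu>=0..n. fact n * (fps_nth (bessel_fps k) \<nu> * fps_nth bern_fps (n - \<nu>)))"
    by (rule sum.mono_neutral_left) (auto simp: bessel_fps_def)
  also have "\<dots> = fact n * fps_nth (bessel_fps k * bern_fps) n"
    by (simp add: fps_mult_nth sum_distrib_left)
  finally show ?thesis
    by (simp add: bsum_def mult.assoc)
qed

lemma bsum_rec:
  "bsum (n + 2) (k + 2) = 2 * (2 * of_nat k + 3) * bsum (n + 2) (k + 1)
     + of_nat (n + 2) * of_nat (n + 1) * (bsum n k :: 'a::field_char_0)"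
proof -
  have "bessel_fps (k + 2) * bern_fps =
      fps_const (2 * (2 * of_nat k + 3)) * (bessel_fps (k + 1) * bern_fps)
      + fps_X ^ 2 * (bessel_fps k * bern_fps :: 'a fps)"
    unfolding bessel_fps_rec by (simp add: algebra_simps)
  then have "fps_nth (bessel_fps (k + 2) * bern_fps) (n + 2) =
      2 * (2 * of_nat k + 3) * fps_nth (bessel_fps (k + 1) * bern_fps) (n + 2)
      + fps_nth (bessel_fps k * bern_fps :: 'a fps) n"
    by (simp add: fps_X_power_mult_nth)
  moreover have "fact (n + 2) = of_nat (n + 2) * of_nat (n + 1) * (fact n :: 'a)"
    by (simp add: algebra_simps)
  ultimately show ?thesis
    unfolding bsum_fps by (simp add: ring_distribs mult_ac)
qed

lemma bsum_0: "bsum n 0 = (-1) ^ n * bernoulli n"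
  by (simp add: bsum_def)

lemma bsum_1: "bsum n 1 = (-1) ^ n * (2 * bernoulli n + of_nat n * bernoulli (n - 1))"
  by (simp add: bsum_def)

subsection \<open>Iterated derivatives\<close>

text \<open>Openness of S is what lets the induction pass from equality of the k-th derivatives on S
  to equality of the next ones.\<close>

lemma deriv_iterate:
  fixes f :: "real \<Rightarrow> real" and g :: "nat \<Rightarrow> real \<Rightarrow> real"
  assumes "open S" and "\<And>x. x \<in> S \<Longrightarrow> f x = g 0 x"
    and "\<And>i x. x \<in> S \<Longrightarrow> (g i has_real_derivative g (Suc i) x) (at x)"
    and "x \<in> S"
  shows "(deriv ^^ k) f x = g k x"
  using assms(4)
proof (induction k arbitrary: x)
  case 0
  then show ?case using assms(2) by simp
next
  case (Suc k)
  have "((deriv ^^ k) f has_real_derivative g (Suc k) x) (at x)"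
    by (rule has_field_derivative_transform_within_open[OF assms(3)[OF Suc.prems] assms(1) Suc.prems])
       (simp add: Suc.IH)
  then show ?case
    by (simp add: DERIV_imp_deriv)
qed

definition leibniz :: "(nat \<Rightarrow> real \<Rightarrow> real) \<Rightarrow> (nat \<Rightarrow> real \<Rightarrow> real) \<Rightarrow> nat \<Rightarrow> real \<Rightarrow> real" where
  "leibniz u v k x = (\<Sum>l\<le>k. of_nat (k choose l) * (v l x * u (k - l) x))"

text \<open>The product rule yields two sums; after an index shift in the first, Pascal's rule
  merges them.\<close>

lemma leibniz_derivative:
  assumes u: "\<And>i. (u i has_real_derivative u (Suc i) x) (at x)"
    and v: "\<And>i. (v i has_real_derivative v (Suc i) x) (at x)"
  shows "(leibniz u v k has_real_derivative leibniz u v (Suc k) x) (at x)"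
proof -
  let ?w = "\<lambda>i j. v i x * u j x"
  have "(leibniz u v k has_real_derivative
      (\<Sum>l\<le>k. of_nat (k choose l) * (v l x * u (Suc (k - l)) x + v (Suc l) x * u (k - l) x))) (at x)"
    unfolding leibniz_def
    by (intro DERIV_sum DERIV_cmult) (rule DERIV_mult'[OF v u])
  also have "(\<Sum>l\<le>k. of_nat (k choose l) * (v l x * u (Suc (k - l)) x + v (Suc l) x * u (k - l) x)) =
      (\<Sum>l\<le>k. of_nat (k choose l) * ?w l (Suc k - l)) + (\<Sum>l\<le>k. of_nat (k choose l) * ?w (Suc l) (k - l))"
    by (simp add: ring_distribs sum.distrib Suc_diff_le)
  also have "(\<Sum>l\<le>k. of_nat (k choose l) * ?w l (Suc k - l)) =
      (\<Sum>l\<le>Suc k. of_nat (k choose l) * ?w l (Suc k - l))"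
    by simp
  also have "\<dots> = ?w 0 (Suc k) + (\<Sum>l\<le>k. of_nat (k choose Suc l) * ?w (Suc l) (k - l))"
    by (subst sum.atMost_Suc_shift) simp
  also have "\<dots> + (\<Sum>l\<le>k. of_nat (k choose l) * ?w (Suc l) (k - l)) = leibniz u v (Suc k) x"
    unfolding leibniz_def by (subst sum.atMost_Suc_shift) (simp add: sum.distrib ring_distribs)
  finally show ?thesis .
qed

text \<open>The i-th derivative of x^m for x > 0. The falling factorial of m is written with
  \<open>gchoose\<close> because m = 2k - j may be negative.\<close>

definition powi_deriv :: "int \<Rightarrow> nat \<Rightarrow> real \<Rightarrow> real" where
  "powi_deriv m i x = fact i * (of_int m gchoose i) * x powi (m - int i)"

lemma powi_deriv_derivative:
  assumes "x > 0"
  shows "(powi_deriv m i has_real_derivative powi_deriv m (Suc i) x) (at x)"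
proof -
  have *: "real_of_int (m - int i) * (real_of_int m gchoose i) = real (Suc i) * (real_of_int m gchoose Suc i)"
    using gbinomial_mult_1[of "real_of_int m" i] by (simp add: algebra_simps)
  have "(powi_deriv m i has_real_derivative
      fact i * (of_int m gchoose i) * (real_of_int (m - int i) * x powi (m - int i - 1))) (at x)"
    unfolding powi_deriv_def using assms
    by (intro DERIV_cmult) (auto intro!: derivative_eq_intros)
  also have "fact i * (of_int m gchoose i) * (real_of_int (m - int i) * x powi (m - int i - 1)) =
     fact i * (real_of_int (m - int i) * (of_int m gchoose i)) * x powi (m - int i - 1)"
    by (simp only: mult_ac)
  also have "\<dots> = powi_deriv m (Suc i) x"
    unfolding * by (simp add: powi_deriv_def mult_ac diff_diff_eq add.commute)
  finally show ?thesis .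
qed

text \<open>The i-th derivative of (x - 1)^j; for i > j the binomial is 0, so the truncated exponent
  does no harm.\<close>

definition pow_deriv :: "nat \<Rightarrow> nat \<Rightarrow> real \<Rightarrow> real" where
  "pow_deriv j i x = fact i * of_nat (j choose i) * (x - 1) ^ (j - i)"

lemma pow_deriv_derivative: "(pow_deriv j i has_real_derivative pow_deriv j (Suc i) x) (at x)"
proof -
  have *: "real (j - i) * real (j choose i) = real (Suc i) * real (j choose Suc i)"
    by (metis binomial_absorb_comp binomial_absorption mult.commute of_nat_mult)
  have "(pow_deriv j i has_real_derivative
      fact i * of_nat (j choose i) * (real (j - i) * (x - 1) ^ (j - i - 1))) (at x)"
    unfolding pow_deriv_def
    by (intro DERIV_cmult) (auto intro!: derivative_eq_intros)
  also have "fact i * of_nat (j choose i) * (real (j - i) * (x - 1) ^ (j - i - 1)) =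
     fact i * (real (j - i) * of_nat (j choose i)) * (x - 1) ^ (j - i - 1)"
    by (simp only: mult_ac)
  also have "\<dots> = pow_deriv j (Suc i) x"
    unfolding * by (simp add: pow_deriv_def mult_ac)
  finally show ?thesis .
qed

text \<open>Only the j-th derivative of (x - 1)^j survives at 1, so the Leibniz sum has at most one
  nonzero term.\<close>

lemma leibniz_at_1:
  "leibniz (powi_deriv (2 * int k - int j)) (pow_deriv j) k 1 =
     (if j \<le> k then fact k * of_nat ((2 * k - j) choose k) else 0)"
proof -
  have z: "pow_deriv j l 1 = (if l = j then fact j else 0)" for l
    by (auto simp: pow_deriv_def power_0_left)
  have "leibniz (powi_deriv (2 * int k - int j)) (pow_deriv j) k 1 =
     (\<Sum>l\<le>k. if l = j then of_nat (k choose j) * (fact j * powi_deriv (2 * int k - int j) (k - j) 1) else 0)"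
    unfolding leibniz_def z by (rule sum.cong) auto
  also have "\<dots> = (if j \<le> k then of_nat (k choose j) * (fact j * powi_deriv (2 * int k - int j) (k - j) 1) else 0)"
    by simp
  also have "\<dots> = (if j \<le> k then fact k * of_nat ((2 * k - j) choose k) else 0)"
  proof (cases "j \<le> k")
    case True
    then have "real_of_int (2 * int k - int j) = real (2 * k - j)"
      by simp
    then have "powi_deriv (2 * int k - int j) (k - j) 1 = fact (k - j) * of_nat ((2 * k - j) choose (k - j))"
      by (simp only: powi_deriv_def binomial_gbinomial power_int_1_left mult_1_right)
    moreover have "(2 * k - j) choose (k - j) = (2 * k - j) choose k"
    proof -
      have "2 * k - j - (k - j) = k \<and> k - j \<le> 2 * k - j"
        using True by presburger
      then show ?thesis
        using binomial_symmetric by metis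
    qed
    ultimately show ?thesis
      using True by (simp add: binomial_fact)
  qed simp
  finally show ?thesis .
qed

lemma frak_b_eq_bsum: "frak_b n k = bsum n k"
proof -
  define c :: "nat \<Rightarrow> real" where "c j = (-1) ^ n * (of_nat (n choose j) * bernoulli (n - j))" for j
  let ?L = "\<lambda>j. leibniz (powi_deriv (2 * int k - int j)) (pow_deriv j)"
  have "(deriv ^^ k) (recip_bernpoly n (2 * int k)) 1 = (\<Sum>j\<le>n. c j * ?L j k 1)"
  proof (rule deriv_iterate[where S = "{0<..}" and g = "\<lambda>i x. \<Sum>j\<le>n. c j * ?L j i x"])
    fix x :: real assume x: "x \<in> {0<..}"
    have "bernpoly n (inverse x) = (-1) ^ n * bernpoly n (1 - inverse x)"
      using bernpoly_reflect[of n "1 - inverse x"] by simp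
    also have "\<dots> = (\<Sum>j\<le>n. c j * (1 - inverse x) ^ j)"
      by (simp add: bernpoly_expand c_def sum_distrib_left mult_ac)
    finally have "recip_bernpoly n (2 * int k) x = (\<Sum>j\<le>n. c j * (x powi (2 * int k) * (1 - inverse x) ^ j))"
      by (simp add: recip_bernpoly_def sum_distrib_left mult_ac)
    also have "\<dots> = (\<Sum>j\<le>n. c j * ?L j 0 x)"
    proof (rule sum.cong[OF refl])
      fix j
      \<comment> \<open>Moving j factors x into the second power exposes (x - 1)^j, whose zero at 1
        has order j.\<close>
      have "x powi (2 * int k) * (1 - inverse x) ^ j = x powi (2 * int k - int j) * (x * (1 - inverse x)) ^ j"
        using x by (simp add: power_int_diff power_mult_distrib)
      also have "x * (1 - inverse x) = x - 1"
        using x by (simp add: field_simps)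
      finally show "c j * (x powi (2 * int k) * (1 - inverse x) ^ j) = c j * ?L j 0 x"
        by (simp add: leibniz_def powi_deriv_def pow_deriv_def)
    qed
    finally show "recip_bernpoly n (2 * int k) x = (\<Sum>j\<le>n. c j * ?L j 0 x)" .
  next
    fix i and x :: real assume x: "x \<in> {0<..}"
    then show "((\<lambda>x. \<Sum>j\<le>n. c j * ?L j i x) has_real_derivative (\<Sum>j\<le>n. c j * ?L j (Suc i) x)) (at x)"
      by (intro DERIV_sum DERIV_cmult leibniz_derivative powi_deriv_derivative pow_deriv_derivative) auto
  qed auto
  also have "\<dots> = (\<Sum>j\<le>n. if j \<le> k then c j * (fact k * of_nat ((2 * k - j) choose k)) else 0)"
    unfolding leibniz_at_1 by (rule sum.cong) auto
  also have "\<dots> = (\<Sum>j\<in>{..n} \<inter> {..k}. c j * (fact k * of_nat ((2 * k - j) choose k)))"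
    by (simp add: sum.If_cases atMost_def)
  also have "\<dots> = (\<Sum>j=0..k. c j * (fact k * of_nat ((2 * k - j) choose k)))"
    by (rule sum.mono_neutral_left) (auto simp: c_def)
  also have "\<dots> = bsum n k"
    by (simp add: bsum_def c_def sum_distrib_left mult_ac)
  finally show ?thesis
    by (simp add: frak_b_def)
qed

text \<open>
  For \<open>n \<le> 2 k\<close> the reciprocal polynomial is a genuine polynomial, and differentiating it without
  the reflection yields the closed formula up to the sign \<open>(-1)\<^sup>n\<close>.
\<close>

lemma frak_b_eq_0:
  assumes "odd n" "n \<le> 2 * k"
  shows "frak_b n k = 0"
proof -
  define c :: "nat \<Rightarrow> real" where "c j = of_nat (n choose j) * bernoulli (n - j)" for j
  let ?L = "\<lambda>j. powi_deriv (2 * int k - int j)"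
  have "(deriv ^^ k) (recip_bernpoly n (2 * int k)) 1 = (\<Sum>j\<le>n. c j * ?L j k 1)"
  proof (rule deriv_iterate[where S = "{0<..}" and g = "\<lambda>i x. \<Sum>j\<le>n. c j * ?L j i x"])
    fix x :: real assume x: "x \<in> {0<..}"
    have "recip_bernpoly n (2 * int k) x = (\<Sum>j\<le>n. c j * (x powi (2 * int k) * inverse x ^ j))"
      by (simp add: recip_bernpoly_def bernpoly_expand c_def sum_distrib_left mult_ac)
    also have "\<dots> = (\<Sum>j\<le>n. c j * ?L j 0 x)"
      using x by (intro sum.cong) (auto simp: powi_deriv_def power_int_diff field_simps)
    finally show "recip_bernpoly n (2 * int k) x = (\<Sum>j\<le>n. c j * ?L j 0 x)" .
  next
    fix i and x :: real assume x: "x \<in> {0<..}"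
    then show "((\<lambda>x. \<Sum>j\<le>n. c j * ?L j i x) has_real_derivative (\<Sum>j\<le>n. c j * ?L j (Suc i) x)) (at x)"
      by (intro DERIV_sum DERIV_cmult powi_deriv_derivative) auto
  qed auto
  also have "\<dots> = (\<Sum>j\<le>n. c j * (fact k * of_nat ((2 * k - j) choose k)))"
  proof (rule sum.cong[OF refl])
    fix j assume "j \<in> {..n}"
    \<comment> \<open>From \<open>n \<le> 2 * k\<close> the exponent is nonnegative, so the
      generalised binomial is an ordinary one, which vanishes for j > k.\<close>
    then have "real_of_int (2 * int k - int j) = real (2 * k - j)"
      using assms by simp
    then show "c j * ?L j k 1 = c j * (fact k * of_nat ((2 * k - j) choose k))"
      by (simp only: powi_deriv_def binomial_gbinomial power_int_1_left mult_1_right)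
  qed
  also have "\<dots> = (\<Sum>j\<in>{..n} \<inter> {..k}. c j * (fact k * of_nat ((2 * k - j) choose k)))"
    using assms by (intro sum.mono_neutral_right) (auto intro!: binomial_eq_0)
  also have "\<dots> = (\<Sum>j=0..k. c j * (fact k * of_nat ((2 * k - j) choose k)))"
    by (rule sum.mono_neutral_left) (auto simp: c_def)
  \<comment> \<open>Oddness of n supplies the minus sign; \<open>frak_b_eq_bsum\<close> gives the
    same value without it, so the value is zero.\<close>
  also have "\<dots> = - bsum n k"
    using assms by (simp add: bsum_def c_def sum_distrib_left sum_negf mult_ac)
  finally show ?thesis
    using frak_b_eq_bsum[of n k] by (simp add: frak_b_def)
qed

lemma bsum_eq_0:
  assumes "odd n" "n \<le> 2 * k"
  shows "bsum n k = (0 :: rat)"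
  using frak_b_eq_0[OF assms] of_rat_bsum[of n k, where 'a = real] by (simp add: frak_b_eq_bsum)

subsection \<open>Signs\<close>

text \<open>The outer induction steps through the odd indices 2m + 3; for each, the inner one
  descends in k from the largest admissible value.\<close>

lemma bsum_sign:
  assumes "k \<le> m"
  shows "0 < (-1) ^ (m + 1) * (bsum (2 * m + 3) (k + 1) :: rat)"
  using assms
proof (induction m arbitrary: k)
  case 0
  have "bsum 3 2 = 6 * bsum 3 1 + 6 * (bsum 1 0 :: rat)"
    using bsum_rec[of 1 0, where 'a = rat] by (simp add: eval_nat_numeral)
  moreover have "bsum 3 2 = (0 :: rat)"
    by (rule bsum_eq_0) auto
  moreover have "bsum 1 0 = (1 / 2 :: rat)"
    unfolding bsum_0 bernoulli_1 by simp
  ultimately show ?case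
    using 0 by simp
next
  case (Suc m)
  \<comment> \<open>Only a weak inequality holds in general: at k = 0 the value is an odd Bernoulli
    number up to sign, hence 0. The strict case starts the descent.\<close>
  have prev: "0 \<le> (-1) ^ (m + 1) * (bsum (2 * m + 3) k :: rat)"
    "k = Suc m \<Longrightarrow> 0 < (-1) ^ (m + 1) * (bsum (2 * m + 3) k :: rat)" if "k \<le> Suc m" for k
  proof -
    have "bsum (2 * m + 3) 0 = (0 :: rat)"
      unfolding bsum_0 by (simp add: bernoulli_odd)
    then show "0 \<le> (-1) ^ (m + 1) * (bsum (2 * m + 3) k :: rat)"
      using Suc.IH[of "k - 1"] that by (cases k) auto
    show "0 < (-1) ^ (m + 1) * (bsum (2 * m + 3) k :: rat)" if "k = Suc m"
      using Suc.IH[of m] that by simp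
  qed
  \<comment> \<open>The sign factor flips from m to m + 1, so in the recurrence solved for the
    middle term both summands enter with a plus.\<close>
  have rec: "2 * (2 * of_nat k + 3) * ((-1) ^ (Suc m + 1) * bsum (2 * Suc m + 3) (k + 1)) =
      (-1) ^ (Suc m + 1) * bsum (2 * Suc m + 3) (k + 2) +
      of_nat ((2 * m + 5) * (2 * m + 4)) * ((-1) ^ (m + 1) * (bsum (2 * m + 3) k :: rat))" for k
  proof -
    have n: "2 * Suc m + 3 = (2 * m + 3) + 2" "2 * m + 5 = (2 * m + 3) + 2" "2 * m + 4 = (2 * m + 3) + 1"
      by simp_all
    show ?thesis
      unfolding n bsum_rec[of "2 * m + 3" k] of_nat_mult by (simp only: power_Suc power_add) (simp add: algebra_simps)
  qed
  have c: "0 < (of_nat ((2 * m + 5) * (2 * m + 4)) :: rat)"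
    by (simp only: of_nat_0_less_iff) simp
  show ?case
    using \<open>k \<le> Suc m\<close>
  proof (induction k rule: inc_induct)
    case base
    have "bsum (2 * Suc m + 3) (Suc m + 2) = (0 :: rat)"
      by (rule bsum_eq_0) auto
    then have "0 < 2 * (2 * of_nat (Suc m) + 3) * ((-1) ^ (Suc m + 1) * (bsum (2 * Suc m + 3) (Suc m + 1) :: rat))"
      unfolding rec using mult_pos_pos[OF c prev(2)[of "Suc m"]] by simp
    then show ?case
      by (rule zero_less_mult_pos) simp
  next
    case (step k)
    have "0 < (-1) ^ (Suc m + 1) * (bsum (2 * Suc m + 3) (k + 2) :: rat)"
      using step.IH by simp
    then have "0 < 2 * (2 * of_nat k + 3) * ((-1) ^ (Suc m + 1) * (bsum (2 * Suc m + 3) (k + 1) :: rat))"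
      unfolding rec using step.hyps
      by (intro add_pos_nonneg mult_nonneg_nonneg prev(1) less_imp_le[OF c]) auto
    then show ?case
      by (rule zero_less_mult_pos) simp
  qed
qed

subsection \<open>Faulhaber polynomials\<close>

definition bernoulli_poly :: "nat \<Rightarrow> rat poly" where
  "bernoulli_poly n = (\<Sum>j\<le>n. monom (of_nat (n choose j) * bernoulli (n - j)) j)"

lemma poly_bernoulli_poly: "poly (bernoulli_poly n) x = bernpoly n x"
  by (simp add: bernoulli_poly_def poly_sum poly_monom bernpoly_expand)

lemma coeff_bernoulli_poly: "coeff (bernoulli_poly n) j = of_nat (n choose j) * bernoulli (n - j)"
  by (simp add: bernoulli_poly_def coeff_sum binomial_eq_0)

lemma pderiv_bernoulli_poly: "pderiv (bernoulli_poly (Suc n)) = smult (of_nat (Suc n)) (bernoulli_poly n)"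
proof (rule poly_eqI)
  fix j
  have "of_nat (Suc j) * of_nat (Suc n choose Suc j) = (of_nat (Suc n) * of_nat (n choose j) :: rat)"
    by (metis Suc_times_binomial_eq of_nat_mult mult.commute)
  then show "coeff (pderiv (bernoulli_poly (Suc n))) j = coeff (smult (of_nat (Suc n)) (bernoulli_poly n)) j"
    by (simp add: coeff_pderiv coeff_bernoulli_poly del: binomial_Suc_Suc of_nat_Suc flip: mult.assoc)
qed

definition power_sum_poly :: "nat \<Rightarrow> rat poly" where
  "power_sum_poly n = smult (1 / of_nat (Suc n)) (bernoulli_poly (Suc n) - [:bernoulli (Suc n):])"

lemma poly_power_sum_poly: "poly (power_sum_poly n) x = power_sum n x"
  by (simp add: power_sum_poly_def power_sum_def poly_bernoulli_poly)

lemma pderiv_power_sum_poly: "pderiv (power_sum_poly n) = bernoulli_poly n"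
  by (simp add: power_sum_poly_def pderiv_smult pderiv_diff pderiv_bernoulli_poly pderiv_pCons del: of_nat_Suc)

lemma pderiv2_power_sum_poly:
  "pderiv (pderiv (power_sum_poly (n + 2))) =
     smult (of_nat (n + 2) * of_nat (n + 1)) (power_sum_poly n) + [:of_nat (n + 2) * bernoulli (n + 1):]"
proof -
  have "pderiv (bernoulli_poly (n + 2)) = smult (of_nat (n + 2)) (bernoulli_poly (n + 1))"
    using pderiv_bernoulli_poly[of "n + 1"] by simp
  then show ?thesis
    unfolding pderiv_power_sum_poly
    by (simp add: power_sum_poly_def smult_diff_right del: of_nat_Suc of_nat_add)
qed

definition S1_poly :: "rat poly" where
  "S1_poly = [:0, - 1 / 2, 1 / 2:]"

lemma power_sum_poly_1: "power_sum_poly 1 = S1_poly"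
proof (rule poly_eqI)
  fix j :: nat
  have "j = 0 \<or> j = 1 \<or> j = 2 \<or> (\<exists>i. j = i + 3)"
    by presburger
  then show "coeff (power_sum_poly 1) j = coeff S1_poly j"
    using bernoulli_1[where 'a = rat]
    by (auto simp: power_sum_poly_def coeff_bernoulli_poly S1_poly_def bernoulli_0
        coeff_pCons eval_nat_numeral split: nat.splits)
qed

lemma poly_S1_poly: "poly S1_poly x = power_sum 1 x"
  by (metis power_sum_poly_1 poly_power_sum_poly)

text \<open>The predicted coefficient of y^j in S_n for odd n; the Faulhaber coefficient of index k
  sits at j = k + 2. The case j = 0 is separate because \<open>j - 1\<close> truncates.\<close>

definition faulhaber_term :: "nat \<Rightarrow> nat \<Rightarrow> rat" where
  "faulhaber_term n j = (if j = 0 then 0 else (-1) ^ (j + 1) * 2 ^ j / fact j * bsum n (j - 1))"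

lemma faulhaber_term_eq_0: "faulhaber_term n j = 0" if "odd n" "n \<le> 2 * (j - 1)"
  using bsum_eq_0[OF that] by (simp add: faulhaber_term_def)

definition power_sum_S1 :: "nat \<Rightarrow> rat poly" where
  "power_sum_S1 n = Abs_poly (faulhaber_term n)"

text \<open>\<open>Abs_poly\<close> needs finite support, which \<open>faulhaber_term_eq_0\<close>
  provides: everything beyond index n vanishes.\<close>

lemma coeff_power_sum_S1: "coeff (power_sum_S1 n) j = faulhaber_term n j" if "odd n"
  unfolding power_sum_S1_def
  by (subst coeff_Abs_poly[of n]) (use that in \<open>auto intro!: faulhaber_term_eq_0\<close>)

text \<open>The equation \<open>S\<^sub>n\<^sub>+\<^sub>2'' = (n + 2) (n + 1) S\<^sub>n + (n + 2) B\<^sub>n\<^sub>+\<^sub>1\<close> written in the variable \<open>y = S\<^sub>1(x)\<close>,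
  where \<open>(y')\<^sup>2 = 2 y + 1/4\<close> and \<open>y'' = 1\<close>.\<close>

lemma power_sum_S1_ode:
  assumes "odd n"
  shows "[:1 / 4, 2:] * pderiv (pderiv (power_sum_S1 (n + 2))) + pderiv (power_sum_S1 (n + 2)) =
     smult (of_nat (n + 2) * of_nat (n + 1)) (power_sum_S1 n) + [:of_nat (n + 2) * bernoulli (n + 1):]"
    (is "?l = ?r")
proof (rule poly_eqI)
  fix j
  have o: "odd (n + 2)"
    using assms by simp
  note co = coeff_power_sum_S1[OF assms] coeff_power_sum_S1[OF o]
  show "coeff ?l j = coeff ?r j"
  proof (cases j)
    case 0
    have "coeff ?l 0 = 1 / 2 * faulhaber_term (n + 2) 2 + faulhaber_term (n + 2) 1"
      by (simp add: coeff_pderiv co[simplified] eval_nat_numeral)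
    \<comment> \<open>The multiples of B_(n+2) cancel here, and only (n + 2) B_(n+1) is
      left.\<close>
    also have "\<dots> = 2 * bsum (n + 2) 0 - bsum (n + 2) 1"
      by (simp add: faulhaber_term_def)
    also have "\<dots> = of_nat (n + 2) * bernoulli (n + 1)"
      unfolding bsum_0 bsum_1 using assms by simp
    also have "\<dots> = coeff ?r 0"
      by (simp add: co faulhaber_term_def)
    finally show ?thesis
      using 0 by simp
  next
    case (Suc i)
    have "coeff ?l (Suc i) = 1 / 4 * (of_nat (i + 2) * of_nat (i + 3) * faulhaber_term (n + 2) (i + 3))
        + 2 * (of_nat (i + 1) * of_nat (i + 2) * faulhaber_term (n + 2) (i + 2))
        + of_nat (i + 2) * faulhaber_term (n + 2) (i + 2)"
      by (simp add: coeff_pderiv co[simplified] eval_nat_numeral algebra_simps)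
    also have "faulhaber_term (n + 2) (i + 3) =
        (-1) ^ i * 2 ^ (i + 3) / (of_nat (i + 3) * of_nat (i + 2) * of_nat (i + 1) * fact i) * bsum (n + 2) (i + 2)"
      by (simp add: faulhaber_term_def eval_nat_numeral mult_ac)
    also have "faulhaber_term (n + 2) (i + 2) =
        - ((-1) ^ i * 2 ^ (i + 2) / (of_nat (i + 2) * of_nat (i + 1) * fact i) * bsum (n + 2) (i + 1))"
      by (simp add: faulhaber_term_def eval_nat_numeral mult_ac)
    \<comment> \<open>The factor 2(2i + 3) is exactly what cancels the other two terms in
      \<open>bsum (n + 2) (i + 1)\<close>, leaving a multiple of \<open>bsum n i\<close>.\<close>
    also have "bsum (n + 2) (i + 2) = 2 * (2 * of_nat i + 3) * bsum (n + 2) (i + 1)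
        + of_nat (n + 2) * of_nat (n + 1) * (bsum n i :: rat)"
      by (rule bsum_rec)
    also have "1 / 4 * (of_nat (i + 2) * of_nat (i + 3) *
          ((-1) ^ i * 2 ^ (i + 3) / (of_nat (i + 3) * of_nat (i + 2) * of_nat (i + 1) * fact i) *
            (2 * (2 * of_nat i + 3) * bsum (n + 2) (i + 1) + of_nat (n + 2) * of_nat (n + 1) * bsum n i)))
        + 2 * (of_nat (i + 1) * of_nat (i + 2) *
          - ((-1) ^ i * 2 ^ (i + 2) / (of_nat (i + 2) * of_nat (i + 1) * fact i) * bsum (n + 2) (i + 1)))
        + of_nat (i + 2) *
          - ((-1) ^ i * 2 ^ (i + 2) / (of_nat (i + 2) * of_nat (i + 1) * fact i) * bsum (n + 2) (i + 1)) =
        of_nat (n + 2) * of_nat (n + 1) * ((-1) ^ i * 2 ^ (i + 1) / (of_nat (i + 1) * fact i) * (bsum n i :: rat))"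
    proof -
      define A B C N b b' where "A = (of_nat (i + 1) :: rat)" and "B = (of_nat (i + 2) :: rat)"
        and "C = (of_nat (i + 3) :: rat)" and "N = (of_nat (n + 2) * of_nat (n + 1) :: rat)"
        and "b = (bsum (n + 2) (i + 1) :: rat)" and "b' = (bsum n i :: rat)"
      have nz: "A \<noteq> 0" "B \<noteq> 0" "C \<noteq> 0" "fact i \<noteq> (0 :: rat)"
        unfolding A_def B_def C_def by (simp_all only: of_nat_eq_0_iff) auto
      have i: "of_nat i = A - 1"
        by (simp add: A_def)
      have p: "2 ^ (i + 3) = 8 * (2 ^ i :: rat)" "2 ^ (i + 2) = 4 * (2 ^ i :: rat)" "2 ^ (i + 1) = 2 * (2 ^ i :: rat)"
        by (simp_all add: power_add)
      show ?thesis
        unfolding A_def[symmetric] B_def[symmetric] C_def[symmetric] N_def[symmetric]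
          b_def[symmetric] b'_def[symmetric] i p
        using nz by (simp add: field_simps)
    qed
    also have "\<dots> = coeff ?r (Suc i)"
      by (simp add: co faulhaber_term_def algebra_simps)
    finally show ?thesis
      using Suc by simp
  qed
qed

section \<open>Identification of the Faulhaber polynomials\<close>

lemma affine_poly_eq_0:
  fixes p :: "rat poly"
  assumes "pderiv (pderiv p) = 0" "poly p 0 = 0" "poly p 1 = 0"
  shows "p = 0"
proof -
  obtain c where c: "pderiv p = [:c:]"
    using assms(1) by (metis degree_eq_zeroE pderiv_eq_0_iff)
  then have "pderiv (p - [:0, c:]) = 0"
    by (simp add: pderiv_diff pderiv_pCons)
  then obtain a where "p - [:0, c:] = [:a:]"
    by (metis degree_eq_zeroE pderiv_eq_0_iff)
  then have p: "p = [:a, c:]"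
    by (simp add: diff_eq_eq)
  then show ?thesis
    using assms(2,3) by simp
qed

text \<open>In the step from m to m + 2 the chain rule turns \<open>power_sum_S1_ode\<close> into
  the second-derivative equation of S_(m+2); both sides vanish at 0 and 1, so
  \<open>affine_poly_eq_0\<close> applies to the difference.\<close>

lemma pcompose_power_sum_S1: "pcompose (power_sum_S1 n) S1_poly = power_sum_poly n" if "odd n"
  using that
proof (induction n rule: less_induct)
  case (less n)
  show ?case
  proof (cases "n = 1")
    case True
    have "power_sum_S1 1 = [:0, 1:]"
    proof (rule poly_eqI)
      fix j
      have "faulhaber_term 1 j = 0" if "j \<ge> 2"
        using that by (intro faulhaber_term_eq_0) auto
      moreover have "faulhaber_term 1 1 = 1"
        using bernoulli_1[where 'a = rat] bsum_0[of 1, where 'a = rat] by (simp add: faulhaber_term_def)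
      ultimately show "coeff (power_sum_S1 1) j = coeff [:0, 1:] j"
        by (subst coeff_power_sum_S1) (auto simp: coeff_pCons faulhaber_term_def split: nat.splits)
    qed
    then show ?thesis
      using True power_sum_poly_1 by (simp add: pcompose_pCons)
  next
    case False
    then obtain m where n: "n = m + 2"
      using less.prems by (metis add_2_eq_Suc' not0_implies_Suc One_nat_def even_zero)
    have m: "odd m" "pcompose (power_sum_S1 m) S1_poly = power_sum_poly m"
      using less n by auto
    let ?G = "power_sum_S1 n" and ?q = S1_poly
    have q: "pderiv (pderiv ?q) = 1"
      "pderiv ?q * pderiv ?q = pcompose [:1 / 4, 2:] ?q"
      by (simp_all add: S1_poly_def pderiv_pCons pcompose_pCons)
    have "pderiv (pderiv (pcompose ?G ?q)) =
        pcompose (pderiv (pderiv ?G)) ?q * (pderiv ?q * pderiv ?q) + pcompose (pderiv ?G) ?q * pderiv (pderiv ?q)"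
      by (simp add: pderiv_pcompose pderiv_mult algebra_simps)
    also have "\<dots> = pcompose ([:1 / 4, 2:] * pderiv (pderiv ?G) + pderiv ?G) ?q"
      unfolding q pcompose_add pcompose_mult by (simp add: mult.commute)
    also have "\<dots> = pderiv (pderiv (power_sum_poly n))"
      unfolding n power_sum_S1_ode[OF m(1)] pderiv2_power_sum_poly pcompose_add pcompose_smult m(2)
      by simp
    finally have D: "pderiv (pderiv (pcompose ?G ?q - power_sum_poly n)) = 0"
      by (simp add: pderiv_diff)
    have "poly ?G 0 = 0"
      using less.prems by (simp add: poly_0_coeff_0 coeff_power_sum_S1 faulhaber_term_def)
    then have ends: "poly (pcompose ?G ?q - power_sum_poly n) x = - power_sum n x" if "x = 0 \<or> x = 1" for x
      using that by (auto simp: poly_pcompose poly_power_sum_poly S1_poly_def)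
    have S: "power_sum n 0 = (0 :: rat)" "power_sum n 1 = (0 :: rat)"
      using n by (simp_all add: power_sum_def bernoulli_def bernpoly_at_1[unfolded bernoulli_def])
    have "pcompose ?G ?q - power_sum_poly n = 0"
      by (rule affine_poly_eq_0[OF D]) (simp_all only: ends S minus_zero simp_thms)
    then show ?thesis
      by simp
  qed
qed

text \<open>For odd \<open>n \<ge> 3\<close> the two lowest coefficients vanish, so the shift is
  exact division by y^2. Uniqueness holds because composition with the nonconstant
  \<open>S1_poly\<close> is injective.\<close>

lemma faulhaber_poly_eq:
  assumes "odd n" "n \<ge> 3"
  shows "faulhaber_poly n = poly_shift 2 (power_sum_S1 n)"
  unfolding faulhaber_poly_def
proof (rule the_equality)
  let ?F = "poly_shift 2 (power_sum_S1 n)"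
  have c: "coeff ?F k = faulhaber_term n (k + 2)" for k
    using assms by (simp add: coeff_poly_shift coeff_power_sum_S1 add.commute)
  define d where "d = faulhaber_deg n"
  have n: "n = 2 * d + 3"
    using assms unfolding d_def faulhaber_deg_def by presburger
  have deg: "degree ?F = d"
  proof (rule antisym)
    show "degree ?F \<le> d"
    proof (rule degree_le, intro allI impI)
      fix k assume "k > d"
      then show "coeff ?F k = 0"
        unfolding c using assms n by (intro faulhaber_term_eq_0) auto
    qed
    \<comment> \<open>The strict sign at the top index k = d shows that the degree is
      attained.\<close>
    have "coeff ?F d \<noteq> 0"
      unfolding c using bsum_sign[of d d] n by (auto simp: faulhaber_term_def)
    then show "d \<le> degree ?F"
      by (rule le_degree)
  qed
  have G: "power_sum_S1 n = pCons 0 (pCons 0 ?F)"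
  proof (rule poly_eqI)
    fix j
    have "faulhaber_term n 1 = 0"
      using assms by (simp add: faulhaber_term_def bsum_0 bernoulli_odd)
    then show "coeff (power_sum_S1 n) j = coeff (pCons 0 (pCons 0 ?F)) j"
      using assms c
      by (auto simp: coeff_pCons coeff_power_sum_S1 faulhaber_term_def split: nat.splits)
  qed
  have eq: "power_sum n x = (power_sum 1 x)\<^sup>2 * poly ?F (power_sum 1 x)" for x :: rat
  proof -
    have "power_sum n x = poly (power_sum_S1 n) (power_sum 1 x)"
      by (metis assms(1) pcompose_power_sum_S1 poly_S1_poly poly_pcompose poly_power_sum_poly)
    then show ?thesis
      by (subst (asm) G) (simp add: power2_eq_square algebra_simps)
  qed
  show "degree ?F = faulhaber_deg n \<and> (\<forall>x::rat. power_sum n x = (power_sum 1 x)\<^sup>2 * poly ?F (power_sum 1 x))"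
    using deg eq d_def by simp
  fix H :: "rat poly"
  assume H: "degree H = faulhaber_deg n \<and> (\<forall>x::rat. power_sum n x = (power_sum 1 x)\<^sup>2 * poly H (power_sum 1 x))"
  \<comment> \<open>Keeping the square as a factor makes this hold at the zeros of
    \<open>S1_poly\<close> too; it is cancelled only afterwards, as a nonzero polynomial.\<close>
  have "poly (S1_poly\<^sup>2 * pcompose (H - ?F) S1_poly) x = 0" for x
    using H eq[of x] by (simp add: poly_pcompose poly_S1_poly algebra_simps)
  then have "S1_poly\<^sup>2 * pcompose (H - ?F) S1_poly = 0"
    using poly_all_0_iff_0 by blast
  moreover have "S1_poly \<noteq> 0" "degree S1_poly > 0"
    by (simp_all add: S1_poly_def)
  ultimately have "H - ?F = 0"
    by (metis mult_eq_0_iff pcompose_eq_0 power_not_zero)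
  then show "H = ?F"
    by simp
qed

lemma faulhaber_coeff_mod_eq: "faulhaber_coeff_mod n k = bsum n (k + 1)" if "odd n" "n \<ge> 3"
proof -
  have "faulhaber_coeff n k = faulhaber_term n (k + 2)"
    using that
    by (simp add: faulhaber_coeff_def faulhaber_poly_eq coeff_poly_shift coeff_power_sum_S1 add.commute)
  also have "\<dots> = (-1) ^ (k + 1) * (2 ^ (k + 2) / fact (k + 2)) * bsum n (k + 1)"
    by (simp add: faulhaber_term_def del: fact_Suc)
  finally show ?thesis
    by (simp add: faulhaber_coeff_mod_def del: fact_Suc)
qed

theorem theorem5p6:
  shows
   "(\<forall>n k :: nat. k \<le> n \<longrightarrow>
       (deriv ^^ k) (recip_bernpoly n (2 * int k)) 1 =
         (-1) ^ n * fact k *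
         (\<Sum>\<nu>=0..k. of_nat ((2 * k - \<nu>) choose k) * of_nat (n choose \<nu>) * bernoulli (n - \<nu>)))
    \<and>
    (\<forall>n k :: nat. n \<ge> 2 \<and> k \<le> n - 2 \<longrightarrow>
       frak_b n (k + 2) =
         2 * (2 * real k + 3) * frak_b n (k + 1) + real n * (real n - 1) * frak_b (n - 2) k)
    \<and>
    (\<forall>n :: nat. odd n \<and> n \<ge> 3 \<longrightarrow>
       (\<forall>k<n. of_rat (faulhaber_coeff_mod n k) = frak_b n (k + 1)) \<and>
       (\<forall>k\<le>faulhaber_deg n. (-1) ^ (faulhaber_deg n + 1) * faulhaber_coeff_mod n k > 0))"
proof (intro conjI allI impI)
  fix n k :: nat
  show "(deriv ^^ k) (recip_bernpoly n (2 * int k)) 1 =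
         (-1) ^ n * fact k *
         (\<Sum>\<nu>=0..k. of_nat ((2 * k - \<nu>) choose k) * of_nat (n choose \<nu>) * bernoulli (n - \<nu>))"
    using frak_b_eq_bsum[of n k] by (simp only: frak_b_def bsum_def)
next
  fix n k :: nat
  assume "n \<ge> 2 \<and> k \<le> n - 2"
  then obtain m where "n = m + 2"
    by (metis add.commute le_Suc_ex)
  then show "frak_b n (k + 2) =
         2 * (2 * real k + 3) * frak_b n (k + 1) + real n * (real n - 1) * frak_b (n - 2) k"
    using bsum_rec[of m k, where 'a = real] by (simp add: frak_b_eq_bsum algebra_simps)
next
  fix n k :: nat
  assume "odd n \<and> n \<ge> 3"
  then show "of_rat (faulhaber_coeff_mod n k) = frak_b n (k + 1)"
    by (simp add: faulhaber_coeff_mod_eq of_rat_bsum frak_b_eq_bsum)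
next
  fix n k :: nat
  assume n: "odd n \<and> n \<ge> 3" and k: "k \<le> faulhaber_deg n"
  then have "n = 2 * faulhaber_deg n + 3"
    unfolding faulhaber_deg_def by presburger
  then show "(-1) ^ (faulhaber_deg n + 1) * faulhaber_coeff_mod n k > 0"
    using bsum_sign[OF k] n by (simp add: faulhaber_coeff_mod_eq)
qed

end
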